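(* Let $\mathcal{M}$ be a finite set of ground terms and $E$ a finite set of (possibly non-ground) equations such that $\mathrm{gnd}_{\mathcal{M}}(s\approx t)\neq\emptyset$ for every $s\approx t\in E$. Consider any run of the calculus $\Rightarrow_{\mathrm{CC}(\mathcal{X})}$ (rules Merge, Deduction, Subsumption) starting from the initial state for $E$, and assume there is a ground term $\alpha\in\mathcal{M}$ such that $\mathcal{M}$ is $\Pi$-closed for $\alpha$ for every state $\Pi$ of the run. Then for any state $\Pi'$ in this run, and for all terms $s,t$ and every grounding substitution $\sigma$ such that there exists a class $A\in\Pi'$ with $\{\Gamma\parallel s,\ \Delta\parallel t\}\subseteq \mathrm{norm}(A)$ and $\Gamma\sigma$ and $\Delta\sigma$ satisfiable, it holds that $\mathrm{gnd}_{\mathcal{M}}(E)\models s\sigma\approx t\sigma$.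
   Context: **Terms.** $\Omega$ is a finite set of function symbols with arities, containing at least one constant and one non-constant symbol; $\mathcal{X}$ is an infinite set of variables; $\mathcal{T}(\Omega,\mathcal{X})$ is the set of terms. The only predicate symbol is equality $\approx$. A term, equation etc. is ground if it contains no variable. A substitution is grounding for an object if applying it makes the object ground. $\mathrm{gnd}_{\mathcal{M}}(E)$ is the set of all ground instances $s\sigma\approx t\sigma$ of equations $s\approx t\in E$ with $s\sigma,t\sigma\in\mathcal{M}$. $\models$ is standard first-order entailment with equality. Mgus are idempotent and introduce no fresh variables. **Constrained terms and classes.** A constraint $\Gamma$ is a finite conjunction of atoms $t\in\mathcal{M}$ ($t$ a term). A ground constraint is true if all its atoms are; a constraint is satisfiable if some grounding instance of it is true. A constrained term $\Gamma\parallel s$ is a term $s$ with a constraint $\Gamma$. A (congruence) class is a finite set $A=\{\Gamma_1\parallel s_1,\dots,\Gamma_n\parallel s_n\}$ of constrained terms. Its separating variables are $X=\mathrm{vars}(s_1)\cap\dots\cap\mathrm{vars}(s_n)$; its free variables are $(\mathrm{vars}(s_1)\cup\dots\cup\mathrm{vars}(s_n))\setminus X$. For a substitution $\mu$, $A\mu=\{\Gamma_i\mu\parallel s_i\mu\}_i$. **Semantics.** With $X$ the separating variables of $A$: $\mathrm{gnd}'(A)=\bigcup_{\sigma\text{ ground},\,\mathrm{dom}(\sigma)=X}\{\{(\Gamma\sigma\parallel s\sigma)\mid(\Gamma\parallel s)\in A,\ \Gamma\sigma\text{ satisfiable}\}\}$ and $\mathrm{gnd}(A)=\bigcup_{B\in\mathrm{gnd}'(A)}\{\bigcup_{\sigma\text{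 grounding for }B}\{s\sigma\mid(\Gamma\parallel s)\in B,\ \Gamma\sigma\text{ true}\}\}$. Thus $\mathrm{gnd}(A)$ is a set of sets of ground terms. A class $B$ subsumes a class $A$ if for every $A'\in\mathrm{gnd}(A)$ there is $B'\in\mathrm{gnd}(B)$ with $A'\subseteq B'$. **Normal class.** $\mathrm{norm}(A)=\{(\Gamma\wedge\Gamma\tau\parallel s)\mid(\Gamma\parallel s)\in A\}\cup\{(\Gamma\wedge\Gamma\tau\parallel s\tau)\mid(\Gamma\parallel s)\in A,\ s\text{ contains free variables of }A\}$, where $\tau$ is a renaming of the free variables of $A$ to fresh variables. **$\Pi$-closed.** For a set $\Pi$ of classes and a ground term $\alpha$, $\mathcal{M}$ is $\Pi$-closed for $\alpha$ if for all (sub)terms $s$ occurring in $\Pi$ and all substitutions $\sigma$ grounding for $s$: if $s\sigma\in\mathcal{M}$ then $s\delta\in\mathcal{M}$ for all $\delta$ such that whenever $x\sigma\neq x\delta$ for a variable $x$, then $x\delta=\alpha$. **The calculus $\Rightarrow_{\mathrm{CC}(\mathcal{X})}$.** A state is a finite set of classes; different classes in a state are variable disjoint (by renaming). The initial state for $E$ is $\{\{s\in\mathcal{M}\wedge t\in\mathcal{M}\parallel s,\ \ s\in\mathcal{M}\wedge t\in\mathcal{M}\parallel t\}\mid s\approx t\in E\}\cup\{\{f(x_1,\dots,x_k)\in\mathcal{M}\parallel f(x_1,\dots,x_k)\}\mid f\in\Omega\text{ of arity }k\}$. The rules are (all unions are set unions; $A$ and $B$ may be identical in Merge and Deduction, in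 which case a renamed copy is used; involved classes are renamed to be variable disjoint): *Merge*: $\Pi\cup\{A,B\}\Rightarrow\Pi\cup\{A,B,(A'\cup B')\mu\}$, provided $\mathrm{norm}(A)=\{\Gamma_1\parallel s_1,\dots,\Gamma_n\parallel s_n\}$, $\mathrm{norm}(B)=\{\Delta_1\parallel t_1,\dots,\Delta_m\parallel t_m\}$, there are $(\Gamma\parallel s)\in A$, $(\Delta\parallel t)\in B$ with $\mu=\mathrm{mgu}(s,t)$, $A'=\{\Gamma_i\wedge\Gamma\wedge\Delta\parallel s_i\mid 1\le i\le n\}$, $B'=\{\Delta_j\wedge\Gamma\wedge\Delta\parallel t_j\mid 1\le j\le m\}$, and no class in $\Pi\cup\{A,B\}$ subsumes $(A'\cup B')\mu$. *Deduction*: $\Pi\cup\{A,B\}\Rightarrow\Pi\cup\{A,B,\{\Gamma'\parallel f(s'_1,\dots,s'_n),\ \Gamma'\parallel f(t'_1,\dots,t'_n)\}\mu\}$, provided $\Gamma\parallel f(s_1,\dots,s_n)\in A$, $\Delta\parallel f(t_1,\dots,t_n)\in B$, for each $0<i\le n$ there is $D_i\in\Pi$ with $\Gamma_i\parallel s'_i\in\mathrm{norm}(D_i)$ and $\Delta_i\parallel t'_i\in\mathrm{norm}(D_i)$, $\mu$ is a simultaneous mgu of $f(s'_1,\dots,s'_n)=f(s_1,\dots,s_n)$ and $f(t'_1,\dots,t'_n)=f(t_1,\dots,t_n)$, $\Gamma'=\Gamma\wedge\Delta\wedge\Gamma_1\wedge\dots\wedge\Gamma_n\wedge\Delta_1\wedge\dots\wedge\Delta_n$,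 and no class in $\Pi\cup\{A,B\}$ subsumes the new class. *Subsumption* (has precedence over the other rules): $\Pi\cup\{A,B\}\Rightarrow\Pi\cup\{B\}$, provided $A\ne B$ and $B$ subsumes $A$. A run is a sequence of rule applications starting from the initial state. *)

theory Defs
  imports Main "HOL-Library.Extended_Nat"
begin

section \<open>Terms and substitutions\<close>

datatype (symbols: 'f, vars: 'v) trm = Var 'v | Fun 'f "('f, 'v) trm list"

text \<open>
  A signature is a set of pairs \<open>(f, k)\<close> of a symbol and its arity. A name that occurs with
  two arities counts as two symbols; the variables are all elements of the type \<open>'v\<close>.
\<close>

type_synonym 'f signature = "('f \<times> nat) set"
type_synonym ('f, 'v) subst = "'v \<Rightarrow> ('f, 'v) trm"
type_synonym ('f, 'v) eqn = "('f, 'v) trm \<times> ('f, 'v) trm"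

inductive_set terms :: "'f signature \<Rightarrow> ('f, 'v) trm set" for \<Omega> where
  Var: "Var x \<in> terms \<Omega>"
| Fun: "(f, length ts) \<in> \<Omega> \<Longrightarrow> (\<And>t. t \<in> set ts \<Longrightarrow> t \<in> terms \<Omega>) \<Longrightarrow> Fun f ts \<in> terms \<Omega>"

definition ground :: "('f, 'v) trm \<Rightarrow> bool" where
  "ground t \<longleftrightarrow> vars t = {}"

primrec subterms :: "('f, 'v) trm \<Rightarrow> ('f, 'v) trm set" where
  "subterms (Var x) = {Var x}"
| "subterms (Fun f ts) = insert (Fun f ts) (\<Union> (set (map subterms ts)))"

primrec subst_apply :: "('f, 'v) trm \<Rightarrow> ('f, 'v) subst \<Rightarrow> ('f, 'v) trm" (infixl "\<cdot>" 67) where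
  "Var x \<cdot> \<sigma> = \<sigma> x"
| "Fun f ts \<cdot> \<sigma> = Fun f (map (\<lambda>t. t \<cdot> \<sigma>) ts)"

definition is_subst :: "'f signature \<Rightarrow> ('f, 'v) subst \<Rightarrow> bool" where
  "is_subst \<Omega> \<sigma> \<longleftrightarrow> (\<forall>x. \<sigma> x \<in> terms \<Omega>)"

definition subst_dom :: "('f, 'v) subst \<Rightarrow> 'v set" where
  "subst_dom \<sigma> = {x. \<sigma> x \<noteq> Var x}"

definition unifies :: "('f, 'v) subst \<Rightarrow> ('f, 'v) eqn set \<Rightarrow> bool" where
  "unifies \<sigma> U \<longleftrightarrow> (\<forall>(u, v) \<in> U. u \<cdot> \<sigma> = v \<cdot> \<sigma>)"

text \<open>
  Simultaneous most general unifiers. The last two conjuncts state the convention that mgus are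
  idempotent and introduce no fresh variables.
\<close>

definition is_mgu :: "'f signature \<Rightarrow> ('f, 'v) subst \<Rightarrow> ('f, 'v) eqn set \<Rightarrow> bool" where
  "is_mgu \<Omega> \<mu> U \<longleftrightarrow>
     is_subst \<Omega> \<mu> \<and> unifies \<mu> U \<and>
     (\<forall>\<theta>. is_subst \<Omega> \<theta> \<and> unifies \<theta> U \<longrightarrow> (\<exists>\<eta>. is_subst \<Omega> \<eta> \<and> (\<forall>x. \<theta> x = \<mu> x \<cdot> \<eta>))) \<and>
     (\<forall>x. \<mu> x \<cdot> \<mu> = \<mu> x) \<and>
     subst_dom \<mu> \<union> (\<Union>x \<in> subst_dom \<mu>. vars (\<mu> x)) \<subseteq> (\<Union>(u, v) \<in> U. vars u \<union> vars v)"


section \<open>First-order entailment with equality\<close>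

primrec eval :: "('f \<Rightarrow> 'a list \<Rightarrow> 'a) \<Rightarrow> ('v \<Rightarrow> 'a) \<Rightarrow> ('f, 'v) trm \<Rightarrow> 'a" where
  "eval I \<beta> (Var x) = \<beta> x"
| "eval I \<beta> (Fun f ts) = I f (map (eval I \<beta>) ts)"

definition is_structure :: "'f signature \<Rightarrow> 'a set \<Rightarrow> ('f \<Rightarrow> 'a list \<Rightarrow> 'a) \<Rightarrow> bool" where
  "is_structure \<Omega> D I \<longleftrightarrow>
     D \<noteq> {} \<and> (\<forall>(f, k) \<in> \<Omega>. \<forall>as. length as = k \<and> set as \<subseteq> D \<longrightarrow> I f as \<in> D)"

definition satisfies :: "'a set \<Rightarrow> ('f \<Rightarrow> 'a list \<Rightarrow> 'a) \<Rightarrow> ('f, 'v) eqn \<Rightarrow> bool" where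
  "satisfies D I e \<longleftrightarrow> (\<forall>\<beta>. range \<beta> \<subseteq> D \<longrightarrow> eval I \<beta> (fst e) = eval I \<beta> (snd e))"

text \<open>
  Entailment over the structures whose domain is a nonempty set of elements of \<open>'a\<close>. A theorem
  that concludes \<open>entails TYPE('a)\<close> for a type variable \<open>'a\<close> speaks about all structures.
\<close>

definition entails :: "'a itself \<Rightarrow> 'f signature \<Rightarrow> ('f, 'v) eqn set \<Rightarrow> ('f, 'v) eqn \<Rightarrow> bool" where
  "entails (T :: 'a itself) \<Omega> N e \<longleftrightarrow>
     (\<forall>(D :: 'a set) I. is_structure \<Omega> D I \<and> (\<forall>e' \<in> N. satisfies D I e') \<longrightarrow> satisfies D I e)"

definition gnd_eqns ::
    "'f signature \<Rightarrow> ('f, 'v) trm set \<Rightarrow> ('f, 'v) eqn set \<Rightarrow> ('f, 'v) eqn set" where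
  "gnd_eqns \<Omega> M E =
     {(s \<cdot> \<sigma>, t \<cdot> \<sigma>) | s t \<sigma>. (s, t) \<in> E \<and> is_subst \<Omega> \<sigma> \<and> s \<cdot> \<sigma> \<in> M \<and> t \<cdot> \<sigma> \<in> M}"


section \<open>Constraints and classes\<close>

text \<open>
  The set \<open>\<Gamma>\<close> of terms stands for the conjunction of the atoms \<open>t \<in> M\<close> with \<open>t \<in> \<Gamma>\<close>, so
  conjunction is union. The pair \<open>(\<Gamma>, s)\<close> is the constrained term \<open>\<Gamma> \<parallel> s\<close>.
\<close>

type_synonym ('f, 'v) constr = "('f, 'v) trm set"
type_synonym ('f, 'v) cterm = "('f, 'v) constr \<times> ('f, 'v) trm"
type_synonym ('f, 'v) cls = "('f, 'v) cterm set"
type_synonym ('f, 'v) state = "('f, 'v) cls set"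

definition constr_subst :: "('f, 'v) constr \<Rightarrow> ('f, 'v) subst \<Rightarrow> ('f, 'v) constr" where
  "constr_subst \<Gamma> \<sigma> = (\<lambda>t. t \<cdot> \<sigma>) ` \<Gamma>"

definition cls_subst :: "('f, 'v) cls \<Rightarrow> ('f, 'v) subst \<Rightarrow> ('f, 'v) cls" where
  "cls_subst A \<sigma> = (\<lambda>(\<Gamma>, s). (constr_subst \<Gamma> \<sigma>, s \<cdot> \<sigma>)) ` A"

definition constr_ground :: "('f, 'v) constr \<Rightarrow> bool" where
  "constr_ground \<Gamma> \<longleftrightarrow> (\<forall>t \<in> \<Gamma>. ground t)"

definition constr_true :: "('f, 'v) trm set \<Rightarrow> ('f, 'v) constr \<Rightarrow> bool" where
  "constr_true M \<Gamma> \<longleftrightarrow> (\<forall>t \<in> \<Gamma>. t \<in> M)"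

definition satisfiable :: "'f signature \<Rightarrow> ('f, 'v) trm set \<Rightarrow> ('f, 'v) constr \<Rightarrow> bool" where
  "satisfiable \<Omega> M \<Gamma> \<longleftrightarrow>
     (\<exists>\<sigma>. is_subst \<Omega> \<sigma> \<and> constr_ground (constr_subst \<Gamma> \<sigma>) \<and> constr_true M (constr_subst \<Gamma> \<sigma>))"

definition cls_ground :: "('f, 'v) cls \<Rightarrow> bool" where
  "cls_ground A \<longleftrightarrow> (\<forall>(\<Gamma>, s) \<in> A. constr_ground \<Gamma> \<and> ground s)"

definition cls_vars :: "('f, 'v) cls \<Rightarrow> 'v set" where
  "cls_vars A = (\<Union>(\<Gamma>, s) \<in> A. (\<Union>t \<in> \<Gamma>. vars t) \<union> vars s)"

definition sep_vars :: "('f, 'v) cls \<Rightarrow> 'v set" where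
  "sep_vars A = (\<Inter>(\<Gamma>, s) \<in> A. vars s)"

definition free_vars :: "('f, 'v) cls \<Rightarrow> 'v set" where
  "free_vars A = (\<Union>(\<Gamma>, s) \<in> A. vars s) - sep_vars A"

definition gnd' :: "'f signature \<Rightarrow> ('f, 'v) trm set \<Rightarrow> ('f, 'v) cls \<Rightarrow> ('f, 'v) cls set" where
  "gnd' \<Omega> M A =
     {{(constr_subst \<Gamma> \<sigma>, s \<cdot> \<sigma>) | \<Gamma> s. (\<Gamma>, s) \<in> A \<and> satisfiable \<Omega> M (constr_subst \<Gamma> \<sigma>)} | \<sigma>.
        is_subst \<Omega> \<sigma> \<and> subst_dom \<sigma> = sep_vars A \<and> (\<forall>x \<in> sep_vars A. ground (\<sigma> x))}"

definition gnd :: "'f signature \<Rightarrow> ('f, 'v) trm set \<Rightarrow> ('f, 'v) cls \<Rightarrow> ('f, 'v) trm set set" where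
  "gnd \<Omega> M A =
     {{s \<cdot> \<sigma> | \<Gamma> s \<sigma>. is_subst \<Omega> \<sigma> \<and> cls_ground (cls_subst B \<sigma>) \<and> (\<Gamma>, s) \<in> B \<and>
                     constr_true M (constr_subst \<Gamma> \<sigma>)} | B. B \<in> gnd' \<Omega> M A}"

definition subsumes ::
    "'f signature \<Rightarrow> ('f, 'v) trm set \<Rightarrow> ('f, 'v) cls \<Rightarrow> ('f, 'v) cls \<Rightarrow> bool" where
  "subsumes \<Omega> M B A \<longleftrightarrow> (\<forall>A' \<in> gnd \<Omega> M A. \<exists>B' \<in> gnd \<Omega> M B. A' \<subseteq> B')"

definition fresh_renaming :: "('f, 'v) cls \<Rightarrow> ('v \<Rightarrow> 'v) \<Rightarrow> bool" where
  "fresh_renaming A \<tau> \<longleftrightarrow>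
     inj_on \<tau> (free_vars A) \<and> \<tau> ` free_vars A \<inter> cls_vars A = {} \<and>
     (\<forall>x. x \<notin> free_vars A \<longrightarrow> \<tau> x = x)"

text \<open>
  The normal class depends on the choice of the renaming \<open>\<tau>\<close> of the free variables;
  it is meant for \<open>\<tau>\<close> with \<open>fresh_renaming A \<tau>\<close>.
\<close>

definition norm_cls :: "('v \<Rightarrow> 'v) \<Rightarrow> ('f, 'v) cls \<Rightarrow> ('f, 'v) cls" where
  "norm_cls \<tau> A =
     {(\<Gamma> \<union> constr_subst \<Gamma> (Var \<circ> \<tau>), s) | \<Gamma> s. (\<Gamma>, s) \<in> A} \<union>
     {(\<Gamma> \<union> constr_subst \<Gamma> (Var \<circ> \<tau>), s \<cdot> (Var \<circ> \<tau>)) | \<Gamma> s.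
        (\<Gamma>, s) \<in> A \<and> vars s \<inter> free_vars A \<noteq> {}}"

definition state_terms :: "('f, 'v) state \<Rightarrow> ('f, 'v) trm set" where
  "state_terms \<Pi> = (\<Union>A \<in> \<Pi>. \<Union>(\<Gamma>, s) \<in> A. \<Union>t \<in> insert s \<Gamma>. subterms t)"

definition closed_for ::
    "'f signature \<Rightarrow> ('f, 'v) trm set \<Rightarrow> ('f, 'v) state \<Rightarrow> ('f, 'v) trm \<Rightarrow> bool" where
  "closed_for \<Omega> M \<Pi> \<alpha> \<longleftrightarrow>
     (\<forall>s \<in> state_terms \<Pi>. \<forall>\<sigma>. is_subst \<Omega> \<sigma> \<and> ground (s \<cdot> \<sigma>) \<and> s \<cdot> \<sigma> \<in> M \<longrightarrow>
        (\<forall>\<delta>. is_subst \<Omega> \<delta> \<and> (\<forall>x. \<sigma> x \<noteq> \<delta> x \<longrightarrow> \<delta> x = \<alpha>) \<longrightarrow> s \<cdot> \<delta> \<in> M))"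


section \<open>The calculus\<close>

definition variant :: "('f, 'v) cls \<Rightarrow> ('f, 'v) cls \<Rightarrow> bool" where
  "variant A A' \<longleftrightarrow> (\<exists>\<rho> :: 'v \<Rightarrow> 'v. inj_on \<rho> (cls_vars A) \<and> A' = cls_subst A (Var \<circ> \<rho>))"

definition var_disjoint :: "('f, 'v) state \<Rightarrow> bool" where
  "var_disjoint \<Pi> \<longleftrightarrow> (\<forall>A \<in> \<Pi>. \<forall>B \<in> \<Pi>. A \<noteq> B \<longrightarrow> cls_vars A \<inter> cls_vars B = {})"

definition eqn_cls :: "('f, 'v) eqn \<Rightarrow> ('f, 'v) cls" where
  "eqn_cls e = (case e of (s, t) \<Rightarrow> {({s, t}, s), ({s, t}, t)})"

definition sym_cls :: "'f \<Rightarrow> 'v list \<Rightarrow> ('f, 'v) cls" where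
  "sym_cls f xs = {({Fun f (map Var xs)}, Fun f (map Var xs))}"

text \<open>
  One class per equation and one per symbol. The functions \<open>p\<close> and \<open>q\<close> choose variants
  such that the different classes of the state are variable disjoint.
\<close>

definition initial :: "'f signature \<Rightarrow> ('f, 'v) eqn set \<Rightarrow> ('f, 'v) state \<Rightarrow> bool" where
  "initial \<Omega> E \<Pi> \<longleftrightarrow>
     (\<exists>p q. (\<forall>e \<in> E. variant (eqn_cls e) (p e)) \<and>
        (\<forall>(f, k) \<in> \<Omega>. \<exists>xs. distinct xs \<and> length xs = k \<and> q (f, k) = sym_cls f xs) \<and>
        \<Pi> = p ` E \<union> q ` \<Omega>) \<and>
     var_disjoint \<Pi>"

definition add_constr :: "('f, 'v) constr \<Rightarrow> ('f, 'v) cls \<Rightarrow> ('f, 'v) cls" where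
  "add_constr \<Theta> A = {(\<Gamma> \<union> \<Theta>, s) | \<Gamma> s. (\<Gamma>, s) \<in> A}"

text \<open>
  The premises are taken from variants \<open>A1\<close>, \<open>B1\<close>, \<open>D1 i\<close> of the classes in the state, which also
  covers the case that the same class is used several times. Disjointness of the normal classes
  makes the renamings of the free variables fresh with respect to all the classes involved. The
  class \<open>C\<close> shares variables with the premises, hence the state is extended by a variant
  \<open>C'\<close> of it. Since \<open>\<Pi> \<union> {A, B}\<close> is a set union, \<open>\<Pi>\<close> may itself contain \<open>A\<close> and \<open>B\<close>.
\<close>

inductive merge :: "'f signature \<Rightarrow> ('f, 'v) trm set \<Rightarrow> ('f, 'v) state \<Rightarrow> ('f, 'v) state \<Rightarrow> bool"
  for \<Omega> :: "'f signature" and M :: "('f, 'v) trm set" where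
  "variant A A1 \<Longrightarrow> variant B B1 \<Longrightarrow>
   fresh_renaming A1 \<tau>A \<Longrightarrow> fresh_renaming B1 \<tau>B \<Longrightarrow>
   cls_vars (norm_cls \<tau>A A1) \<inter> cls_vars (norm_cls \<tau>B B1) = {} \<Longrightarrow>
   (\<Gamma>, s) \<in> A1 \<Longrightarrow> (\<Delta>, t) \<in> B1 \<Longrightarrow> is_mgu \<Omega> \<mu> {(s, t)} \<Longrightarrow>
   C = cls_subst (add_constr (\<Gamma> \<union> \<Delta>) (norm_cls \<tau>A A1) \<union>
                  add_constr (\<Gamma> \<union> \<Delta>) (norm_cls \<tau>B B1)) \<mu> \<Longrightarrow>
   (\<forall>G \<in> \<Pi> \<union> {A, B}. \<not> subsumes \<Omega> M G C) \<Longrightarrow>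
   variant C C' \<Longrightarrow> (\<forall>G \<in> \<Pi> \<union> {A, B}. cls_vars C' \<inter> cls_vars G = {}) \<Longrightarrow>
   merge \<Omega> M (\<Pi> \<union> {A, B}) (\<Pi> \<union> {A, B, C'})"

inductive deduction ::
    "'f signature \<Rightarrow> ('f, 'v) trm set \<Rightarrow> ('f, 'v) state \<Rightarrow> ('f, 'v) state \<Rightarrow> bool"
  for \<Omega> :: "'f signature" and M :: "('f, 'v) trm set" where
  "variant A A1 \<Longrightarrow> variant B B1 \<Longrightarrow>
   (\<Gamma>, Fun f ss) \<in> A1 \<Longrightarrow> (\<Delta>, Fun f ts) \<in> B1 \<Longrightarrow> length ss = n \<Longrightarrow> length ts = n \<Longrightarrow>
   (\<forall>i < n. D i \<in> \<Pi> \<and> variant (D i) (D1 i) \<and> fresh_renaming (D1 i) (\<tau> i) \<and>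
      (\<Gamma>s i, s' i) \<in> norm_cls (\<tau> i) (D1 i) \<and> (\<Delta>s i, t' i) \<in> norm_cls (\<tau> i) (D1 i)) \<Longrightarrow>
   cls_vars A1 \<inter> cls_vars B1 = {} \<Longrightarrow>
   (\<forall>i < n. cls_vars (norm_cls (\<tau> i) (D1 i)) \<inter> (cls_vars A1 \<union> cls_vars B1) = {}) \<Longrightarrow>
   (\<forall>i < n. \<forall>j < n. i \<noteq> j \<longrightarrow>
      cls_vars (norm_cls (\<tau> i) (D1 i)) \<inter> cls_vars (norm_cls (\<tau> j) (D1 j)) = {}) \<Longrightarrow>
   is_mgu \<Omega> \<mu> {(Fun f (map s' [0..<n]), Fun f ss), (Fun f (map t' [0..<n]), Fun f ts)} \<Longrightarrow>
   \<Gamma>' = \<Gamma> \<union> \<Delta> \<union> (\<Union>i < n. \<Gamma>s i) \<union> (\<Union>i < n. \<Delta>s i) \<Longrightarrow>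
   C = cls_subst {(\<Gamma>', Fun f (map s' [0..<n])), (\<Gamma>', Fun f (map t' [0..<n]))} \<mu> \<Longrightarrow>
   (\<forall>G \<in> \<Pi> \<union> {A, B}. \<not> subsumes \<Omega> M G C) \<Longrightarrow>
   variant C C' \<Longrightarrow> (\<forall>G \<in> \<Pi> \<union> {A, B}. cls_vars C' \<inter> cls_vars G = {}) \<Longrightarrow>
   deduction \<Omega> M (\<Pi> \<union> {A, B}) (\<Pi> \<union> {A, B, C'})"

inductive subsumption ::
    "'f signature \<Rightarrow> ('f, 'v) trm set \<Rightarrow> ('f, 'v) state \<Rightarrow> ('f, 'v) state \<Rightarrow> bool"
  for \<Omega> :: "'f signature" and M :: "('f, 'v) trm set" where
  "A \<noteq> B \<Longrightarrow> subsumes \<Omega> M B A \<Longrightarrow> subsumption \<Omega> M (\<Pi> \<union> {A, B}) (\<Pi> \<union> {B})"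

definition cc_step ::
    "'f signature \<Rightarrow> ('f, 'v) trm set \<Rightarrow> ('f, 'v) state \<Rightarrow> ('f, 'v) state \<Rightarrow> bool" where
  "cc_step \<Omega> M \<Pi> \<Pi>' \<longleftrightarrow>
     subsumption \<Omega> M \<Pi> \<Pi>' \<or>
     (\<not> (\<exists>\<Pi>''. subsumption \<Omega> M \<Pi> \<Pi>'') \<and> (merge \<Omega> M \<Pi> \<Pi>' \<or> deduction \<Omega> M \<Pi> \<Pi>'))"

text \<open>
  A run with \<open>N\<close> rule applications consists of the states \<open>S i\<close> with \<open>i \<le> N\<close>; it is
  infinite for \<open>N = \<infinity>\<close>.
\<close>

definition cc_run ::
    "'f signature \<Rightarrow> ('f, 'v) trm set \<Rightarrow> ('f, 'v) eqn set \<Rightarrow> enat \<Rightarrow>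
     (nat \<Rightarrow> ('f, 'v) state) \<Rightarrow> bool" where
  "cc_run \<Omega> M E N S \<longleftrightarrow>
     initial \<Omega> E (S 0) \<and> (\<forall>i. enat (Suc i) \<le> N \<longrightarrow> cc_step \<Omega> M (S i) (S (Suc i)))"

end

theory Submission
  imports Defs
begin

text \<open>
  Fix a model of the ground instances of \<open>E\<close>. The invariant is that any two true instances of
  constrained terms of a class, taken under substitutions that agree on the separating variables
  of the class, have the same value. It is stronger than the claim in that it allows
  two different substitutions of the free variables.

  To preserve it for a new class \<open>C\<close>, two substitutions \<open>\<sigma>\<close>, \<open>\<sigma>'\<close> that agree on the
  separating variables of \<open>C\<close> are joined through the substitution that maps all other variables
  to \<open>\<alpha>\<close>; closedness keeps the constraints true. Not being a separating variable of \<open>C\<close>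
  means to be missing from one of the two premises (Merge) or sides (Deduction). So the variables
  can be reset in two stages, each of which fixes the separating variables of one
  premise (Merge), or of all the premises \<open>D\<^sub>i\<close> (Deduction), where the invariant applies.
\<close>

section \<open>Substitutions and their composition\<close>

lemma subst_cong: "(\<And>x. x \<in> vars t \<Longrightarrow> \<sigma> x = \<delta> x) \<Longrightarrow> t \<cdot> \<sigma> = t \<cdot> \<delta>"
  by (induction t) auto

lemma subst_subst: "t \<cdot> \<sigma> \<cdot> \<delta> = t \<cdot> (\<lambda>x. \<sigma> x \<cdot> \<delta>)"
  by (induction t) auto

lemma subst_Var: "t \<cdot> Var = t"
  by (induction t) (auto intro: map_idI)

lemma ground_subst: "ground t \<Longrightarrow> t \<cdot> \<sigma> = t"
  using subst_cong[of t \<sigma> Var] by (simp add: ground_def subst_Var)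

lemma vars_subst: "vars (t \<cdot> \<sigma>) = (\<Union>x \<in> vars t. vars (\<sigma> x))"
  by (induction t) auto

lemma self_in_subterms: "t \<in> subterms t"
  by (cases t) auto

lemma terms_subst: "t \<in> terms \<Omega> \<Longrightarrow> is_subst \<Omega> \<sigma> \<Longrightarrow> t \<cdot> \<sigma> \<in> terms \<Omega>"
proof (induction rule: terms.induct)
  case (Fun f ts)
  then show ?case using terms.Fun[of f "map (\<lambda>t. t \<cdot> \<sigma>) ts" \<Omega>] by auto
qed (simp add: is_subst_def)

lemma is_subst_comp: "is_subst \<Omega> \<sigma> \<Longrightarrow> is_subst \<Omega> \<delta> \<Longrightarrow> is_subst \<Omega> (\<lambda>x. \<sigma> x \<cdot> \<delta>)"
  by (simp add: is_subst_def terms_subst)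

lemma subst_rename: "t \<cdot> (Var \<circ> \<rho>) \<cdot> \<sigma> = t \<cdot> (\<sigma> \<circ> \<rho>)"
  by (simp add: subst_subst comp_def)

section \<open>Truth of constraint instances and the invariant\<close>

definition holds :: "('f, 'v) trm set \<Rightarrow> ('f, 'v) constr \<Rightarrow> ('f, 'v) subst \<Rightarrow> bool" where
  "holds M \<Gamma> \<sigma> \<longleftrightarrow> (\<forall>t \<in> \<Gamma>. t \<cdot> \<sigma> \<in> M)"

lemma holds_mono: "holds M \<Gamma> \<sigma> \<Longrightarrow> \<Delta> \<subseteq> \<Gamma> \<Longrightarrow> holds M \<Delta> \<sigma>"
  by (auto simp: holds_def)

lemma holds_Un: "holds M (\<Gamma> \<union> \<Delta>) \<sigma> \<longleftrightarrow> holds M \<Gamma> \<sigma> \<and> holds M \<Delta> \<sigma>"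
  by (auto simp: holds_def)

lemma holds_constr_subst: "holds M (constr_subst \<Gamma> \<mu>) \<sigma> \<longleftrightarrow> holds M \<Gamma> (\<lambda>x. \<mu> x \<cdot> \<sigma>)"
  by (simp add: holds_def constr_subst_def subst_subst)

lemma satisfiable_holds:
  assumes "satisfiable \<Omega> M (constr_subst \<Gamma> \<sigma>)"
  obtains \<eta> where "is_subst \<Omega> \<eta>" "holds M \<Gamma> (\<lambda>x. \<sigma> x \<cdot> \<eta>)"
  using assms
  by (auto simp: satisfiable_def constr_true_def holds_def constr_subst_def subst_subst)

text \<open>\<open>h\<close> abstracts evaluation in a fixed model under a fixed assignment.
  \<open>X\<close> is a parameter so that a normal class can be judged by the separating variables
  of the class it comes from.\<close>

definition consistent ::
    "'f signature \<Rightarrow> ('f, 'v) trm set \<Rightarrow> (('f, 'v) trm \<Rightarrow> 'a) \<Rightarrow> 'v set \<Rightarrow> ('f, 'v) cls \<Rightarrow> bool" where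
  "consistent \<Omega> M h X A \<longleftrightarrow>
     (\<forall>\<Gamma> s \<Delta> t \<sigma> \<sigma>'. (\<Gamma>, s) \<in> A \<longrightarrow> (\<Delta>, t) \<in> A \<longrightarrow> is_subst \<Omega> \<sigma> \<longrightarrow> is_subst \<Omega> \<sigma>' \<longrightarrow>
        holds M \<Gamma> \<sigma> \<longrightarrow> holds M \<Delta> \<sigma>' \<longrightarrow> (\<forall>x \<in> X. \<sigma> x = \<sigma>' x) \<longrightarrow> h (s \<cdot> \<sigma>) = h (t \<cdot> \<sigma>'))"

lemma consistentD:
  assumes "consistent \<Omega> M h X A" "(\<Gamma>, s) \<in> A" "(\<Delta>, t) \<in> A" "is_subst \<Omega> \<sigma>" "is_subst \<Omega> \<sigma>'"
    "holds M \<Gamma> \<sigma>" "holds M \<Delta> \<sigma>'" "\<And>x. x \<in> X \<Longrightarrow> \<sigma> x = \<sigma>' x"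
  shows "h (s \<cdot> \<sigma>) = h (t \<cdot> \<sigma>')"
  using assms unfolding consistent_def by blast

lemma sep_vars_subset: "(\<Gamma>, s) \<in> A \<Longrightarrow> sep_vars A \<subseteq> vars s"
  by (auto simp: sep_vars_def)

lemma sep_vars_rename: "x \<in> sep_vars A \<Longrightarrow> \<rho> x \<in> sep_vars (cls_subst A (Var \<circ> \<rho>))"
  by (fastforce simp: sep_vars_def cls_subst_def vars_subst)

text \<open>An instance of a member of \<open>A'\<close> under \<open>\<sigma>\<close> is the
  instance of a member of \<open>A\<close> under \<open>\<sigma> \<circ> \<rho>\<close>. Since
  \<open>\<rho>\<close> sends separating variables to separating variables, agreement of two
  substitutions is inherited.\<close>

lemma consistent_variant:
  assumes "consistent \<Omega> M h (sep_vars A) A" "variant A A'"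
  shows "consistent \<Omega> M h (sep_vars A') A'"
proof -
  obtain \<rho> where A': "A' = cls_subst A (Var \<circ> \<rho>)"
    using assms(2) by (auto simp: variant_def)
  show ?thesis unfolding consistent_def
  proof (intro allI impI)
    fix \<Gamma> s \<Delta> t \<sigma> \<sigma>'
    assume *: "(\<Gamma>, s) \<in> A'" "(\<Delta>, t) \<in> A'" "is_subst \<Omega> \<sigma>" "is_subst \<Omega> \<sigma>'"
      "holds M \<Gamma> \<sigma>" "holds M \<Delta> \<sigma>'" "\<forall>x \<in> sep_vars A'. \<sigma> x = \<sigma>' x"
    obtain \<Gamma>0 s0 \<Delta>0 t0 where 0: "(\<Gamma>0, s0) \<in> A" "(\<Delta>0, t0) \<in> A"
      "\<Gamma> = constr_subst \<Gamma>0 (Var \<circ> \<rho>)" "s = s0 \<cdot> (Var \<circ> \<rho>)"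
      "\<Delta> = constr_subst \<Delta>0 (Var \<circ> \<rho>)" "t = t0 \<cdot> (Var \<circ> \<rho>)"
      using *(1,2) by (auto simp: A' cls_subst_def)
    have "h (s0 \<cdot> (\<sigma> \<circ> \<rho>)) = h (t0 \<cdot> (\<sigma>' \<circ> \<rho>))"
      using assms(1) 0(1,2)
    proof (rule consistentD)
      show "is_subst \<Omega> (\<sigma> \<circ> \<rho>)" "is_subst \<Omega> (\<sigma>' \<circ> \<rho>)"
        using * by (simp_all add: is_subst_def)
      show "holds M \<Gamma>0 (\<sigma> \<circ> \<rho>)" "holds M \<Delta>0 (\<sigma>' \<circ> \<rho>)"
        using *(5,6) by (simp_all add: 0 holds_constr_subst comp_def)
      show "(\<sigma> \<circ> \<rho>) x = (\<sigma>' \<circ> \<rho>) x" if "x \<in> sep_vars A" for x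
        using *(7) sep_vars_rename[OF that] by (auto simp: A')
    qed
    then show "h (s \<cdot> \<sigma>) = h (t \<cdot> \<sigma>')"
      by (simp add: 0 subst_rename)
  qed
qed

text \<open>Lets original, unrenamed and renamed members be treated alike, as members of
  \<open>A\<close> renamed by \<open>id\<close> or \<open>\<tau>\<close>. For the constraint an
  inclusion suffices, because a larger conjunction is stronger.\<close>

lemma norm_cls_cases:
  assumes "(\<Gamma>', u) \<in> A \<union> norm_cls \<tau> A"
  obtains \<Gamma> s \<theta> where "(\<Gamma>, s) \<in> A" "\<theta> = id \<or> \<theta> = \<tau>"
    "u = s \<cdot> (Var \<circ> \<theta>)" "constr_subst \<Gamma> (Var \<circ> \<theta>) \<subseteq> \<Gamma>'"
proof -
  have "\<exists>\<Gamma> s \<theta>. (\<Gamma>, s) \<in> A \<and> (\<theta> = id \<or> \<theta> = \<tau>) \<and> u = s \<cdot> (Var \<circ> \<theta>) \<and>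
    constr_subst \<Gamma> (Var \<circ> \<theta>) \<subseteq> \<Gamma>'"
  proof (cases "\<exists>\<Gamma>. (\<Gamma>, u) \<in> A \<and> \<Gamma> \<subseteq> \<Gamma>'")
    case True
    then show ?thesis by (metis (mono_tags, lifting) comp_id constr_subst_def image_cong image_ident subst_Var)
  next
    case False
    with assms show ?thesis by (auto simp: norm_cls_def)
  qed
  then show thesis using that by blast
qed

lemma fresh_renaming_sep: "fresh_renaming A \<tau> \<Longrightarrow> x \<in> sep_vars A \<Longrightarrow> \<tau> x = x"
  by (auto simp: fresh_renaming_def free_vars_def)

text \<open>Both possible renamings, \<open>id\<close> and \<open>\<tau>\<close>, fix the separating
  variables, so these survive in every member of the normal class.\<close>

lemma sep_vars_norm:
  assumes "fresh_renaming A \<tau>" "(\<Gamma>, s) \<in> norm_cls \<tau> A"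
  shows "sep_vars A \<subseteq> vars s"
proof -
  obtain \<Gamma>0 s0 \<theta> where "(\<Gamma>0, s0) \<in> A" "\<theta> = id \<or> \<theta> = \<tau>" "s = s0 \<cdot> (Var \<circ> \<theta>)"
    using norm_cls_cases assms(2) by (metis UnCI)
  then show ?thesis
    using sep_vars_subset[of \<Gamma>0 s0 A] fresh_renaming_sep[OF assms(1)]
    by (force simp: vars_subst)
qed

text \<open>This is where two different substitutions in the invariant pay off: a plain and a
  renamed copy under one \<open>\<sigma>\<close> are instances under \<open>\<sigma>\<close> and
  \<open>\<sigma> \<circ> \<tau>\<close>, which agree on the separating variables only.
  \<open>A\<close> is kept in the union so that the unified premise of Merge can be compared with
  the normal class.\<close>

lemma consistent_norm:
  assumes "consistent \<Omega> M h (sep_vars A) A" "fresh_renaming A \<tau>"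
  shows "consistent \<Omega> M h (sep_vars A) (A \<union> norm_cls \<tau> A)"
  unfolding consistent_def
proof (intro allI impI)
  fix \<Gamma> s \<Delta> t \<sigma> \<sigma>'
  assume *: "(\<Gamma>, s) \<in> A \<union> norm_cls \<tau> A" "(\<Delta>, t) \<in> A \<union> norm_cls \<tau> A"
    "is_subst \<Omega> \<sigma>" "is_subst \<Omega> \<sigma>'" "holds M \<Gamma> \<sigma>" "holds M \<Delta> \<sigma>'"
    "\<forall>x \<in> sep_vars A. \<sigma> x = \<sigma>' x"
  obtain \<Gamma>0 s0 \<theta> where 1: "(\<Gamma>0, s0) \<in> A" "\<theta> = id \<or> \<theta> = \<tau>"
    "s = s0 \<cdot> (Var \<circ> \<theta>)" "constr_subst \<Gamma>0 (Var \<circ> \<theta>) \<subseteq> \<Gamma>"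
    using norm_cls_cases[OF *(1)] .
  obtain \<Delta>0 t0 \<theta>' where 2: "(\<Delta>0, t0) \<in> A" "\<theta>' = id \<or> \<theta>' = \<tau>"
    "t = t0 \<cdot> (Var \<circ> \<theta>')" "constr_subst \<Delta>0 (Var \<circ> \<theta>') \<subseteq> \<Delta>"
    using norm_cls_cases[OF *(2)] .
  have "h (s0 \<cdot> (\<sigma> \<circ> \<theta>)) = h (t0 \<cdot> (\<sigma>' \<circ> \<theta>'))"
    using assms(1) 1(1) 2(1)
  proof (rule consistentD)
    show "is_subst \<Omega> (\<sigma> \<circ> \<theta>)" "is_subst \<Omega> (\<sigma>' \<circ> \<theta>')"
      using * by (simp_all add: is_subst_def)
    show "holds M \<Gamma>0 (\<sigma> \<circ> \<theta>)" "holds M \<Delta>0 (\<sigma>' \<circ> \<theta>')"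
      using holds_mono[OF *(5) 1(4)] holds_mono[OF *(6) 2(4)]
      by (simp_all add: holds_constr_subst comp_def)
    show "(\<sigma> \<circ> \<theta>) x = (\<sigma>' \<circ> \<theta>') x" if "x \<in> sep_vars A" for x
    proof -
      have "\<theta> x = x" "\<theta>' x = x" using 1(2) 2(2) fresh_renaming_sep[OF assms(2) that] by auto
      then show ?thesis using *(7) that by simp
    qed
  qed
  then show "h (s \<cdot> \<sigma>) = h (t \<cdot> \<sigma>')"
    by (simp add: 1 2 subst_rename)
qed

section \<open>Resetting variables to the closing term\<close>

definition reset :: "('f, 'v) trm \<Rightarrow> 'v set \<Rightarrow> ('f, 'v) subst \<Rightarrow> ('f, 'v) subst" where
  "reset \<alpha> Y \<sigma> x = (if x \<in> Y then \<sigma> x else \<alpha>)"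

lemma is_subst_reset: "\<alpha> \<in> terms \<Omega> \<Longrightarrow> is_subst \<Omega> \<sigma> \<Longrightarrow> is_subst \<Omega> (reset \<alpha> Y \<sigma>)"
  by (auto simp: is_subst_def reset_def)

lemma reset_reset: "reset \<alpha> Y (reset \<alpha> Z \<sigma>) = reset \<alpha> (Y \<inter> Z) \<sigma>"
  by (auto simp: reset_def)

lemma reset_cong: "(\<And>x. x \<in> Y \<Longrightarrow> \<sigma> x = \<sigma>' x) \<Longrightarrow> reset \<alpha> Y \<sigma> = reset \<alpha> Y \<sigma>'"
  by (auto simp: reset_def)

lemma subst_reset: "vars t \<subseteq> Y \<Longrightarrow> t \<cdot> reset \<alpha> Y \<sigma> = t \<cdot> \<sigma>"
  by (rule subst_cong) (auto simp: reset_def)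

text \<open>The form in which closedness is used. It is stated for the unrenamed conclusion
  \<open>C\<close> of a rule, which shares its variables with the premises, whereas the state
  contains only a variant of \<open>C\<close>.\<close>

definition resettable ::
    "'f signature \<Rightarrow> ('f, 'v) trm set \<Rightarrow> ('f, 'v) trm \<Rightarrow> ('f, 'v) cls \<Rightarrow> bool" where
  "resettable \<Omega> M \<alpha> C \<longleftrightarrow>
     (\<forall>\<Gamma> s \<sigma> Y. (\<Gamma>, s) \<in> C \<longrightarrow> is_subst \<Omega> \<sigma> \<longrightarrow> holds M \<Gamma> \<sigma> \<longrightarrow> holds M \<Gamma> (reset \<alpha> Y \<sigma>))"

lemma resettableD:
  "resettable \<Omega> M \<alpha> C \<Longrightarrow> (\<Gamma>, s) \<in> C \<Longrightarrow> is_subst \<Omega> \<sigma> \<Longrightarrow> holds M \<Gamma> \<sigma> \<Longrightarrow>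
     holds M \<Gamma> (reset \<alpha> Y \<sigma>)"
  unfolding resettable_def by blast

lemma closed_for_resettable:
  assumes closed: "closed_for \<Omega> M \<Pi> \<alpha>" and "C' \<in> \<Pi>" and "variant C C'"
    and \<alpha>: "\<alpha> \<in> terms \<Omega>" and M: "\<forall>u \<in> M. ground u"
  shows "resettable \<Omega> M \<alpha> C"
  unfolding resettable_def holds_def
proof (intro allI impI ballI)
  fix \<Gamma> s \<sigma> Y t
  assume Cs: "(\<Gamma>, s) \<in> C" and \<sigma>: "is_subst \<Omega> \<sigma>" and tM: "\<forall>t \<in> \<Gamma>. t \<cdot> \<sigma> \<in> M" and t: "t \<in> \<Gamma>"
  obtain \<rho> where inj: "inj_on \<rho> (cls_vars C)" and C': "C' = cls_subst C (Var \<circ> \<rho>)"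
    using \<open>variant C C'\<close> by (auto simp: variant_def)
  \<comment> \<open>Turns a substitution for \<open>C\<close> into one for the variant
    \<open>C'\<close> by inverting \<open>\<rho>\<close>. With the default \<open>\<alpha>\<close>
    outside the image, the two pulled substitutions below can differ only at variables that are
    reset.\<close>
  define pull where
    "pull \<delta> y = (if y \<in> \<rho> ` cls_vars C then \<delta> (inv_into (cls_vars C) \<rho> y) else \<alpha>)" for \<delta> y
  have vars_t: "vars t \<subseteq> cls_vars C"
    using Cs t by (auto simp: cls_vars_def)
  have "pull \<delta> (\<rho> x) = \<delta> x" if "x \<in> vars t" for \<delta> x
  proof -
    have "x \<in> cls_vars C" using that vars_t by blast
    then show ?thesis using inj by (simp add: pull_def)
  qed
  then have pull: "t \<cdot> (Var \<circ> \<rho>) \<cdot> pull \<delta> = t \<cdot> \<delta>" for \<delta>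
    unfolding subst_rename by (intro subst_cong) simp
  have is_subst_pull: "is_subst \<Omega> (pull \<delta>)" if "is_subst \<Omega> \<delta>" for \<delta>
    using that \<alpha> by (auto simp: is_subst_def pull_def)
  \<comment> \<open>Closedness applies to the atoms of constraints because they count among the
    terms of the state.\<close>
  have t_in: "t \<cdot> (Var \<circ> \<rho>) \<in> state_terms \<Pi>"
  proof -
    have "(constr_subst \<Gamma> (Var \<circ> \<rho>), s \<cdot> (Var \<circ> \<rho>)) \<in> C'"
      using Cs by (force simp: C' cls_subst_def)
    moreover have "t \<cdot> (Var \<circ> \<rho>) \<in> constr_subst \<Gamma> (Var \<circ> \<rho>)"
      using t by (simp add: constr_subst_def)
    ultimately show ?thesis
      using \<open>C' \<in> \<Pi>\<close> self_in_subterms unfolding state_terms_def by fast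
  qed
  have "t \<cdot> (Var \<circ> \<rho>) \<cdot> pull (reset \<alpha> Y \<sigma>) \<in> M"
  proof -
    have "t \<cdot> \<sigma> \<in> M" using tM t by blast
    moreover have "pull \<sigma> x \<noteq> pull (reset \<alpha> Y \<sigma>) x \<longrightarrow> pull (reset \<alpha> Y \<sigma>) x = \<alpha>" for x
      by (auto simp: pull_def reset_def)
    ultimately show ?thesis
      using closed t_in is_subst_pull[OF \<sigma>] is_subst_pull[OF is_subst_reset[OF \<alpha> \<sigma>]] M pull[of \<sigma>]
      unfolding closed_for_def by metis
  qed
  then show "t \<cdot> reset \<alpha> Y \<sigma> \<in> M" by (simp add: pull)
qed

text \<open>
  Resetting the variables that do not occur in the image of the separating variables \<open>X\<close>
  under \<open>\<mu>\<close> is invisible on \<open>X\<close>, so it does not change the value.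
\<close>

lemma consistent_reset:
  assumes A: "consistent \<Omega> M h X A" "(\<Gamma>, s) \<in> A"
    and \<mu>: "is_subst \<Omega> \<mu>" and \<sigma>: "is_subst \<Omega> \<sigma>" and \<alpha>: "\<alpha> \<in> terms \<Omega>"
    and h: "holds M (constr_subst \<Gamma> \<mu>) \<sigma>" "holds M (constr_subst \<Gamma> \<mu>) (reset \<alpha> Y \<sigma>)"
    and Y: "\<And>x. x \<in> X \<Longrightarrow> vars (\<mu> x) \<subseteq> Y"
  shows "h (s \<cdot> \<mu> \<cdot> \<sigma>) = h (s \<cdot> \<mu> \<cdot> reset \<alpha> Y \<sigma>)"
  unfolding subst_subst
  by (rule consistentD[OF A A(2)])
    (use h Y \<mu> \<sigma> \<alpha> in \<open>auto simp: holds_constr_subst is_subst_comp is_subst_reset subst_reset\<close>)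

section \<open>Preservation by Merge and Deduction\<close>

lemma consistent_merge:
  assumes A: "consistent \<Omega> M h (sep_vars A) A" "fresh_renaming A \<tau>A" "(\<Gamma>, s) \<in> A"
    and B: "consistent \<Omega> M h (sep_vars B) B" "fresh_renaming B \<tau>B" "(\<Delta>, t) \<in> B"
    and \<mu>: "is_subst \<Omega> \<mu>" "s \<cdot> \<mu> = t \<cdot> \<mu>" and \<alpha>: "\<alpha> \<in> terms \<Omega>"
    and C: "C = cls_subst (add_constr (\<Gamma> \<union> \<Delta>) (norm_cls \<tau>A A) \<union>
                  add_constr (\<Gamma> \<union> \<Delta>) (norm_cls \<tau>B B)) \<mu>"
    and reset: "resettable \<Omega> M \<alpha> C"
  shows "consistent \<Omega> M h (sep_vars C) C"
proof -
  \<comment> \<open>The variables of \<open>C\<close> through which the separating variables of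
    \<open>A\<close> (below: of \<open>B\<close>) are seen after unification. A reset that keeps
    them is invisible to the invariant of that premise.\<close>
  define YA where "YA = (\<Union>x \<in> sep_vars A. vars (\<mu> x))"
  define YB where "YB = (\<Union>x \<in> sep_vars B. vars (\<mu> x))"
  \<comment> \<open>Each term of \<open>C\<close> stems from one of the two normal classes, so it
    contains all of \<open>YA\<close> or all of \<open>YB\<close>, and in either case their
    intersection.\<close>
  have Y_sub: "YA \<inter> YB \<subseteq> sep_vars C"
  proof
    fix x assume x: "x \<in> YA \<inter> YB"
    have "x \<in> vars u" if u: "(\<Theta>, u) \<in> C" for \<Theta> u
    proof -
      obtain \<Theta>0 v where v: "u = v \<cdot> \<mu>" "(\<Theta>0, v) \<in> norm_cls \<tau>A A \<or> (\<Theta>0, v) \<in> norm_cls \<tau>B B"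
        using u by (auto simp: C cls_subst_def add_constr_def)
      then have "sep_vars A \<subseteq> vars v \<or> sep_vars B \<subseteq> vars v"
        using sep_vars_norm[OF A(2)] sep_vars_norm[OF B(2)] by blast
      then show ?thesis using x by (auto simp: v vars_subst YA_def YB_def)
    qed
    then show "x \<in> sep_vars C" by (auto simp: sep_vars_def)
  qed
  let ?\<Theta> = "constr_subst (\<Gamma> \<union> \<Delta>) \<mu>"
  \<comment> \<open>A canonical value for all true instances of \<open>C\<close> under
    \<open>\<sigma>\<close>: it depends on \<open>\<sigma>\<close> only through the variables in
    \<open>YB \<inter> YA\<close>.\<close>
  have meet: "h (u \<cdot> \<sigma>) = h (s \<cdot> \<mu> \<cdot> reset \<alpha> (YB \<inter> YA) \<sigma>)"
    if u: "(\<Theta>, u) \<in> C" and \<sigma>: "is_subst \<Omega> \<sigma>" and hold: "holds M \<Theta> \<sigma>" for \<Theta> u \<sigma>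
  proof -
    have sub: "?\<Theta> \<subseteq> \<Theta>"
      using u by (auto simp: C cls_subst_def add_constr_def constr_subst_def)
    have hr: "holds M ?\<Theta> (reset \<alpha> Y \<sigma>)" for Y
      using holds_mono[OF resettableD[OF reset u \<sigma> hold] sub] .
    have h0: "holds M ?\<Theta> \<sigma>" using holds_mono[OF hold sub] .
    \<comment> \<open>Under a single substitution, \<open>v\<close> is compared with the unified
      term of its own premise; \<open>s \<cdot> \<mu> = t \<cdot> \<mu>\<close> is the bridge
      between the premises.\<close>
    have 1: "h (u \<cdot> \<sigma>) = h (s \<cdot> \<mu> \<cdot> \<sigma>)"
    proof -
      obtain \<Theta>0 v where v: "u = v \<cdot> \<mu>" "\<Theta> = constr_subst (\<Theta>0 \<union> (\<Gamma> \<union> \<Delta>)) \<mu>"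
        "(\<Theta>0, v) \<in> norm_cls \<tau>A A \<or> (\<Theta>0, v) \<in> norm_cls \<tau>B B"
        using u by (auto simp: C cls_subst_def add_constr_def)
      let ?\<sigma> = "\<lambda>x. \<mu> x \<cdot> \<sigma>"
      have \<sigma>': "is_subst \<Omega> ?\<sigma>" by (rule is_subst_comp[OF \<mu>(1) \<sigma>])
      have hold': "holds M \<Theta>0 ?\<sigma>" "holds M \<Gamma> ?\<sigma>" "holds M \<Delta> ?\<sigma>"
        using hold by (simp_all add: v(2) holds_constr_subst holds_Un)
      from v(3) show ?thesis
      proof
        assume "(\<Theta>0, v) \<in> norm_cls \<tau>A A"
        then have "h (v \<cdot> ?\<sigma>) = h (s \<cdot> ?\<sigma>)"
          using consistentD[OF consistent_norm[OF A(1,2)] _ _ \<sigma>' \<sigma>' hold'(1,2)] A(3) by blast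
        then show ?thesis by (simp add: v subst_subst)
      next
        assume "(\<Theta>0, v) \<in> norm_cls \<tau>B B"
        then have "h (v \<cdot> ?\<sigma>) = h (t \<cdot> ?\<sigma>)"
          using consistentD[OF consistent_norm[OF B(1,2)] _ _ \<sigma>' \<sigma>' hold'(1,3)] B(3) by blast
        then show ?thesis by (simp add: v \<mu>(2)) (simp add: subst_subst)
      qed
    qed
    \<comment> \<open>The common term is reset first as a member of \<open>A\<close>, keeping
      \<open>YA\<close>, and then as a member of \<open>B\<close>, keeping \<open>YB\<close>. The
      added constraints \<open>\<Gamma>\<close> and \<open>\<Delta>\<close> make both premises
      applicable.\<close>
    also have "\<dots> = h (s \<cdot> \<mu> \<cdot> reset \<alpha> YA \<sigma>)"
      by (rule consistent_reset[OF A(1,3) \<mu>(1) \<sigma> \<alpha>])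
        (use h0 hr in \<open>auto simp: holds_constr_subst holds_Un YA_def\<close>)
    also have "\<dots> = h (t \<cdot> \<mu> \<cdot> reset \<alpha> YB (reset \<alpha> YA \<sigma>))"
      unfolding \<mu>(2)
      by (rule consistent_reset[OF B(1,3) \<mu>(1) is_subst_reset[OF \<alpha> \<sigma>] \<alpha>])
        (use hr in \<open>auto simp: holds_constr_subst holds_Un YB_def reset_reset\<close>)
    finally show ?thesis by (simp add: reset_reset \<mu>(2))
  qed
  show ?thesis unfolding consistent_def
  proof (intro allI impI)
    fix \<Theta> u \<Theta>' u' \<sigma> \<sigma>'
    assume *: "(\<Theta>, u) \<in> C" "(\<Theta>', u') \<in> C" "is_subst \<Omega> \<sigma>" "is_subst \<Omega> \<sigma>'"
      "holds M \<Theta> \<sigma>" "holds M \<Theta>' \<sigma>'" "\<forall>x \<in> sep_vars C. \<sigma> x = \<sigma>' x"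
    have "reset \<alpha> (YB \<inter> YA) \<sigma> = reset \<alpha> (YB \<inter> YA) \<sigma>'"
      by (rule reset_cong) (use *(7) Y_sub in blast)
    then show "h (u \<cdot> \<sigma>) = h (u' \<cdot> \<sigma>')"
      using meet[OF *(1,3,5)] meet[OF *(2,4,6)] by simp
  qed
qed

text \<open>Congruence reduces every comparison of the two sides to their arguments, where the
  invariant of the classes \<open>D i\<close> applies.\<close>

lemma consistent_deduction:
  assumes D: "\<And>i. i < n \<Longrightarrow> consistent \<Omega> M h (sep_vars (D i)) (D i)"
      "\<And>i. i < n \<Longrightarrow> fresh_renaming (D i) (\<tau> i)"
      "\<And>i. i < n \<Longrightarrow> (\<Gamma> i, s i) \<in> norm_cls (\<tau> i) (D i)"
      "\<And>i. i < n \<Longrightarrow> (\<Delta> i, t i) \<in> norm_cls (\<tau> i) (D i)"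
    and sub: "\<And>i. i < n \<Longrightarrow> \<Gamma> i \<subseteq> \<Theta>" "\<And>i. i < n \<Longrightarrow> \<Delta> i \<subseteq> \<Theta>"
    and cong: "\<And>us vs. map h us = map h vs \<Longrightarrow> h (Fun f us) = h (Fun f vs)"
    and \<mu>: "is_subst \<Omega> \<mu>" and \<alpha>: "\<alpha> \<in> terms \<Omega>"
    and C: "C = cls_subst {(\<Theta>, Fun f (map s [0..<n])), (\<Theta>, Fun f (map t [0..<n]))} \<mu>"
    and reset: "resettable \<Omega> M \<alpha> C"
  shows "consistent \<Omega> M h (sep_vars C) C"
proof -
  let ?fs = "Fun f (map s [0..<n]) \<cdot> \<mu>" and ?ft = "Fun f (map t [0..<n]) \<cdot> \<mu>"
  let ?\<Theta> = "constr_subst \<Theta> \<mu>"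
  have C_eq: "C = {(?\<Theta>, ?fs), (?\<Theta>, ?ft)}"
    by (simp add: C cls_subst_def)
  have sep: "sep_vars C = vars ?fs \<inter> vars ?ft"
    by (simp only: C_eq sep_vars_def) auto
  have norm: "consistent \<Omega> M h (sep_vars (D i)) (norm_cls (\<tau> i) (D i))" if "i < n" for i
    using consistent_norm[OF D(1)[OF that] D(2)[OF that]] unfolding consistent_def by blast
  \<comment> \<open>A separating variable of \<open>D i\<close> occurs in both \<open>s i\<close>
    and \<open>t i\<close>, hence its image under \<open>\<mu>\<close> lies in both sides. Dropping
    variables that are missing from one side is therefore invisible to all
    \<open>D i\<close>.\<close>
  have sep_D: "vars (\<mu> x) \<subseteq> vars ?fs" "vars (\<mu> x) \<subseteq> vars ?ft"
    if "i < n" "x \<in> sep_vars (D i)" for i x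
  proof -
    have "x \<in> vars (s i)" "x \<in> vars (t i)"
      using that(2) sep_vars_norm[OF D(2) D(3)] sep_vars_norm[OF D(2) D(4)] that(1) by blast+
    then show "vars (\<mu> x) \<subseteq> vars ?fs" "vars (\<mu> x) \<subseteq> vars ?ft"
      using that(1) by (auto simp: vars_subst)
  qed
  have hold_i: "holds M (constr_subst (\<Gamma> i) \<mu>) \<sigma>" "holds M (constr_subst (\<Delta> i) \<mu>) \<sigma>"
    if "holds M ?\<Theta> \<sigma>" "i < n" for i \<sigma>
    using that(1) holds_mono[OF _ sub(1)[OF that(2)]] holds_mono[OF _ sub(2)[OF that(2)]]
    by (auto simp: holds_constr_subst)
  have args: "h (?fs \<cdot> \<sigma>) = h (?ft \<cdot> \<sigma>)" if "is_subst \<Omega> \<sigma>" "holds M ?\<Theta> \<sigma>" for \<sigma>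
  proof -
    have "h (s i \<cdot> \<mu> \<cdot> \<sigma>) = h (t i \<cdot> \<mu> \<cdot> \<sigma>)" if "i < n" for i
      unfolding subst_subst
      by (rule consistentD[OF norm D(3,4)])
        (use that \<open>is_subst \<Omega> \<sigma>\<close> \<open>holds M ?\<Theta> \<sigma>\<close> hold_i \<mu>
          in \<open>auto simp: is_subst_comp holds_constr_subst\<close>)
    then show ?thesis by (auto intro!: cong)
  qed
  \<comment> \<open>The left side is reset to the variables of the right side, then exchanged for
    the right side, which is reset to the variables of the left side. What is kept is the
    intersection, that is \<open>sep_vars C\<close>.\<close>
  have meet: "h (?fs \<cdot> \<sigma>) = h (?ft \<cdot> reset \<alpha> (sep_vars C) \<sigma>)"
    if \<sigma>: "is_subst \<Omega> \<sigma>" and hold: "holds M ?\<Theta> \<sigma>" for \<sigma>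
  proof -
    have hr: "holds M ?\<Theta> (reset \<alpha> Y \<sigma>)" for Y
      using resettableD[OF reset _ \<sigma> hold] unfolding C_eq by blast
    have "h (s i \<cdot> \<mu> \<cdot> \<sigma>) = h (s i \<cdot> \<mu> \<cdot> reset \<alpha> (vars ?ft) \<sigma>)" if i: "i < n" for i
      by (rule consistent_reset[OF norm[OF i] D(3)[OF i] \<mu> \<sigma> \<alpha> hold_i(1)[OF hold i]
            hold_i(1)[OF hr i] sep_D(2)[OF i]])
    then have "h (?fs \<cdot> \<sigma>) = h (?fs \<cdot> reset \<alpha> (vars ?ft) \<sigma>)"
      by (auto intro!: cong)
    also have "\<dots> = h (?ft \<cdot> reset \<alpha> (vars ?ft) \<sigma>)"
      by (rule args[OF is_subst_reset[OF \<alpha> \<sigma>] hr])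
    also have "\<dots> = h (?ft \<cdot> reset \<alpha> (vars ?fs) (reset \<alpha> (vars ?ft) \<sigma>))"
    proof -
      have "h (t i \<cdot> \<mu> \<cdot> reset \<alpha> (vars ?ft) \<sigma>) =
          h (t i \<cdot> \<mu> \<cdot> reset \<alpha> (vars ?fs) (reset \<alpha> (vars ?ft) \<sigma>))" if i: "i < n" for i
        by (rule consistent_reset[OF norm[OF i] D(4)[OF i] \<mu> is_subst_reset[OF \<alpha> \<sigma>] \<alpha>
              hold_i(2)[OF hr i] _ sep_D(1)[OF i]])
          (use hold_i(2)[OF hr i] in \<open>auto simp only: reset_reset\<close>)
      then show ?thesis by (auto intro!: cong)
    qed
    finally show ?thesis unfolding reset_reset sep .
  qed
  show ?thesis unfolding consistent_def
  proof (intro allI impI)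
    fix \<Theta>1 u \<Theta>2 u' \<sigma> \<sigma>'
    assume *: "(\<Theta>1, u) \<in> C" "(\<Theta>2, u') \<in> C" "is_subst \<Omega> \<sigma>" "is_subst \<Omega> \<sigma>'"
      "holds M \<Theta>1 \<sigma>" "holds M \<Theta>2 \<sigma>'" "\<forall>x \<in> sep_vars C. \<sigma> x = \<sigma>' x"
    have hold: "holds M ?\<Theta> \<sigma>" "holds M ?\<Theta> \<sigma>'"
      using * by (auto simp only: C_eq prod.inject insert_iff empty_iff)
    have u: "u = ?fs \<or> u = ?ft" "u' = ?fs \<or> u' = ?ft"
      using * by (auto simp only: C_eq prod.inject insert_iff empty_iff)
    have "h (u \<cdot> \<sigma>) = h (?fs \<cdot> \<sigma>)" "h (u' \<cdot> \<sigma>') = h (?fs \<cdot> \<sigma>')"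
      using u args[OF *(3) hold(1)] args[OF *(4) hold(2)] by metis+
    moreover have "reset \<alpha> (sep_vars C) \<sigma> = reset \<alpha> (sep_vars C) \<sigma>'"
      by (rule reset_cong) (use *(7) in blast)
    ultimately show "h (u \<cdot> \<sigma>) = h (u' \<cdot> \<sigma>')"
      using meet[OF *(3) hold(1)] meet[OF *(4) hold(2)] by metis
  qed
qed

section \<open>The initial classes\<close>

lemma consistent_eqn_cls:
  assumes eq: "\<And>\<sigma>. is_subst \<Omega> \<sigma> \<Longrightarrow> a \<cdot> \<sigma> \<in> M \<Longrightarrow> b \<cdot> \<sigma> \<in> M \<Longrightarrow> h (a \<cdot> \<sigma>) = h (b \<cdot> \<sigma>)"
  shows "consistent \<Omega> M h (sep_vars (eqn_cls (a, b))) (eqn_cls (a, b))"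
  unfolding consistent_def
proof (intro allI impI)
  fix \<Gamma> s \<Delta> t \<sigma> \<sigma>'
  assume *: "(\<Gamma>, s) \<in> eqn_cls (a, b)" "(\<Delta>, t) \<in> eqn_cls (a, b)" "is_subst \<Omega> \<sigma>" "is_subst \<Omega> \<sigma>'"
    "holds M \<Gamma> \<sigma>" "holds M \<Delta> \<sigma>'" "\<forall>x \<in> sep_vars (eqn_cls (a, b)). \<sigma> x = \<sigma>' x"
  have M: "a \<cdot> \<sigma> \<in> M" "b \<cdot> \<sigma> \<in> M" "a \<cdot> \<sigma>' \<in> M" "b \<cdot> \<sigma>' \<in> M"
    using * by (auto simp: eqn_cls_def holds_def)
  \<comment> \<open>Both members carry both atoms, so all four instances are in \<open>M\<close>. As
    \<open>\<delta>\<close> and \<open>\<delta>'\<close> agree on the shared variables, they can be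
    glued into one substitution, which yields a genuine instance of the equation.\<close>
  have mix: "h (a \<cdot> \<delta>) = h (b \<cdot> \<delta>')"
    if "is_subst \<Omega> \<delta>" "is_subst \<Omega> \<delta>'" "a \<cdot> \<delta> \<in> M" "b \<cdot> \<delta>' \<in> M"
      "\<forall>x \<in> vars a \<inter> vars b. \<delta> x = \<delta>' x" for \<delta> \<delta>'
  proof -
    let ?\<eta> = "\<lambda>x. if x \<in> vars a then \<delta> x else \<delta>' x"
    have "a \<cdot> ?\<eta> = a \<cdot> \<delta>" "b \<cdot> ?\<eta> = b \<cdot> \<delta>'"
      using that(5) by (auto intro!: subst_cong)
    moreover have "is_subst \<Omega> ?\<eta>" using that by (simp add: is_subst_def)
    ultimately show ?thesis using eq[of ?\<eta>] that by simp
  qed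
  have agree: "\<forall>x \<in> vars a \<inter> vars b. \<sigma> x = \<sigma>' x"
    using *(7) by (auto simp: eqn_cls_def sep_vars_def)
  \<comment> \<open>Together with \<open>eq\<close> for \<open>\<sigma>'\<close> these equate all
    four values; two instances of the same side are linked through the other side.\<close>
  have "h (a \<cdot> \<sigma>) = h (b \<cdot> \<sigma>)" "h (a \<cdot> \<sigma>) = h (b \<cdot> \<sigma>')" "h (a \<cdot> \<sigma>') = h (b \<cdot> \<sigma>)"
    using mix[of \<sigma> \<sigma>'] mix[of \<sigma>' \<sigma>] eq[of \<sigma>] M *(3,4) agree by simp_all
  moreover have "s = a \<or> s = b" "t = a \<or> t = b"
    using * by (auto simp: eqn_cls_def)
  ultimately show "h (s \<cdot> \<sigma>) = h (t \<cdot> \<sigma>')"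
    using eq[OF *(4) M(3,4)] by auto
qed

text \<open>All variables of the only member are separating, so agreeing substitutions produce the
  same instance.\<close>

lemma consistent_sym_cls: "consistent \<Omega> M h (sep_vars (sym_cls f xs)) (sym_cls f xs)"
proof -
  have "Fun f (map Var xs) \<cdot> \<sigma> = Fun f (map Var xs) \<cdot> \<sigma>'"
    if "\<forall>x \<in> sep_vars (sym_cls f xs). \<sigma> x = \<sigma>' x" for \<sigma> \<sigma>'
    using that by (intro subst_cong) (auto simp: sym_cls_def sep_vars_def)
  then show ?thesis
    unfolding consistent_def by (auto simp only: sym_cls_def prod.inject insert_iff empty_iff)
qed

lemma consistent_initial:
  assumes "initial \<Omega> E \<Pi>" "A \<in> \<Pi>"
    and eq: "\<And>a b \<sigma>. (a, b) \<in> E \<Longrightarrow> is_subst \<Omega> \<sigma> \<Longrightarrow> a \<cdot> \<sigma> \<in> M \<Longrightarrow> b \<cdot> \<sigma> \<in> M \<Longrightarrow>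
      h (a \<cdot> \<sigma>) = h (b \<cdot> \<sigma>)"
  shows "consistent \<Omega> M h (sep_vars A) A"
proof -
  have "(\<exists>e \<in> E. variant (eqn_cls e) A) \<or> (\<exists>f xs. A = sym_cls f xs)"
    using assms(1,2) unfolding initial_def by fast
  then show ?thesis
  proof (elim disjE bexE exE)
    fix e assume "e \<in> E" "variant (eqn_cls e) A"
    moreover obtain a b where "e = (a, b)" by fastforce
    ultimately show ?thesis
      using consistent_variant[OF consistent_eqn_cls[of \<Omega> a M b h]] eq by blast
  qed (simp add: consistent_sym_cls)
qed

section \<open>The invariant along a run\<close>

lemma consistent_step:
  assumes step: "cc_step \<Omega> M \<Pi> \<Pi>'"
    and inv: "\<And>A. A \<in> \<Pi> \<Longrightarrow> consistent \<Omega> M h (sep_vars A) A"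
    and cong: "\<And>f us vs. map h us = map h vs \<Longrightarrow> h (Fun f us) = h (Fun f vs)"
    and closed: "closed_for \<Omega> M \<Pi>' \<alpha>" and \<alpha>: "\<alpha> \<in> terms \<Omega>" and M: "\<forall>u \<in> M. ground u"
    and A: "A \<in> \<Pi>'"
  shows "consistent \<Omega> M h (sep_vars A) A"
proof -
  consider "subsumption \<Omega> M \<Pi> \<Pi>'" | "merge \<Omega> M \<Pi> \<Pi>'" | "deduction \<Omega> M \<Pi> \<Pi>'"
    using step by (auto simp: cc_step_def)
  then show ?thesis
  proof cases
    case 1
    \<comment> \<open>Subsumption only removes classes.\<close>
    then show ?thesis using A inv by cases blast
  next
    case 2
    then show ?thesis
    proof cases
      case (1 A0 A1 B0 B1 \<tau>A \<tau>B \<Gamma> s \<Delta> t \<mu> C \<Pi>0 C')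
      \<comment> \<open>Closedness of the state after the step is what is needed here, since that
        state contains the variant \<open>C'\<close> of the new class.\<close>
      have "resettable \<Omega> M \<alpha> C"
        by (rule closed_for_resettable[OF closed _ _ \<alpha> M, of C']) (use 1 in auto)
      moreover have "consistent \<Omega> M h (sep_vars A1) A1" "consistent \<Omega> M h (sep_vars B1) B1"
        using 1 inv by (auto intro: consistent_variant)
      moreover have "is_subst \<Omega> \<mu>" "s \<cdot> \<mu> = t \<cdot> \<mu>"
        using 1 by (auto simp: is_mgu_def unifies_def)
      ultimately have "consistent \<Omega> M h (sep_vars C) C"
        using consistent_merge[of \<Omega> M h A1 \<tau>A \<Gamma> s B1 \<tau>B \<Delta> t \<mu> \<alpha> C] 1 \<alpha> by blast
      then have "consistent \<Omega> M h (sep_vars C') C'"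
        using 1 consistent_variant by blast
      moreover have "A = C' \<or> A \<in> \<Pi>" using A unfolding 1(1,2) by blast
      ultimately show ?thesis using inv by blast
    qed
  next
    case 3
    then show ?thesis
    proof cases
      case (1 A0 A1 B0 B1 \<Gamma> f ss \<Delta> ts n D \<Pi>0 D1 \<tau> \<Gamma>s s' \<Delta>s t' \<mu> \<Gamma>' C C')
      have "resettable \<Omega> M \<alpha> C"
        by (rule closed_for_resettable[OF closed _ _ \<alpha> M, of C']) (use 1 in auto)
      moreover have "consistent \<Omega> M h (sep_vars (D1 i)) (D1 i)" if "i < n" for i
        using 1(1,9) that inv consistent_variant[of \<Omega> M h "D i" "D1 i"] by blast
      moreover have "is_subst \<Omega> \<mu>"
        using 1(13) by (simp add: is_mgu_def)
      moreover have "\<Gamma>s i \<subseteq> \<Gamma>'" "\<Delta>s i \<subseteq> \<Gamma>'" if "i < n" for i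
        using 1(14) that by auto
      ultimately have "consistent \<Omega> M h (sep_vars C) C"
        by (intro consistent_deduction[of n \<Omega> M h D1 \<tau> \<Gamma>s s' \<Delta>s t' \<Gamma>' f,
              OF _ _ _ _ _ _ cong _ \<alpha> 1(15)])
          (simp_all add: 1(9))
      then have "consistent \<Omega> M h (sep_vars C') C'"
        using 1 consistent_variant by blast
      moreover have "A = C' \<or> A \<in> \<Pi>" using A unfolding 1(1,2) by blast
      ultimately show ?thesis using inv by blast
    qed
  qed
qed

lemma consistent_run:
  assumes run: "cc_run \<Omega> M E N S" and closed: "\<And>i. enat i \<le> N \<Longrightarrow> closed_for \<Omega> M (S i) \<alpha>"
    and eq: "\<And>a b \<sigma>. (a, b) \<in> E \<Longrightarrow> is_subst \<Omega> \<sigma> \<Longrightarrow> a \<cdot> \<sigma> \<in> M \<Longrightarrow> b \<cdot> \<sigma> \<in> M \<Longrightarrow>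
      h (a \<cdot> \<sigma>) = h (b \<cdot> \<sigma>)"
    and cong: "\<And>f us vs. map h us = map h vs \<Longrightarrow> h (Fun f us) = h (Fun f vs)"
    and \<alpha>: "\<alpha> \<in> terms \<Omega>" and M: "\<forall>u \<in> M. ground u"
  shows "enat j \<le> N \<Longrightarrow> A \<in> S j \<Longrightarrow> consistent \<Omega> M h (sep_vars A) A"
proof (induction j arbitrary: A)
  case 0
  then show ?case using consistent_initial[of \<Omega> E "S 0" A M h] eq run by (auto simp: cc_run_def)
next
  case (Suc j)
  have "enat j \<le> N" using Suc.prems(1) by (meson enat_ord_simps(1) le_SucI order_refl order_trans)
  moreover have "cc_step \<Omega> M (S j) (S (Suc j))" using run Suc.prems(1) by (auto simp: cc_run_def)
  ultimately show ?case
    using consistent_step[OF _ Suc.IH cong closed[OF Suc.prems(1)] \<alpha> M Suc.prems(2)] by blast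
qed

theorem lemma16:
  fixes \<Omega> :: "'f signature"
    and M :: "('f, 'v) trm set"
    and E :: "('f, 'v) eqn set"
    and \<alpha> s t :: "('f, 'v) trm"
    and \<Gamma> \<Delta> :: "('f, 'v) constr"
    and \<sigma> :: "('f, 'v) subst"
    and S :: "nat \<Rightarrow> ('f, 'v) state"
    and N :: enat
  assumes "finite \<Omega>" and "\<exists>c. (c, 0) \<in> \<Omega>" and "\<exists>f k. (f, k) \<in> \<Omega> \<and> k > 0"
    and "infinite (UNIV :: 'v set)"
    and "finite M" and "\<forall>u \<in> M. u \<in> terms \<Omega> \<and> ground u"
    and "finite E" and "E \<subseteq> terms \<Omega> \<times> terms \<Omega>"
    and "\<forall>e \<in> E. gnd_eqns \<Omega> M {e} \<noteq> {}"
    and "cc_run \<Omega> M E N S"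
    and "\<alpha> \<in> M" and "\<forall>i. enat i \<le> N \<longrightarrow> closed_for \<Omega> M (S i) \<alpha>"
    and "enat j \<le> N" and "A \<in> S j"
    and "fresh_renaming A \<tau>" and "{(\<Gamma>, s), (\<Delta>, t)} \<subseteq> norm_cls \<tau> A"
    and "is_subst \<Omega> \<sigma>" and "ground (s \<cdot> \<sigma>)" and "ground (t \<cdot> \<sigma>)"
    and "satisfiable \<Omega> M (constr_subst \<Gamma> \<sigma>)" and "satisfiable \<Omega> M (constr_subst \<Delta> \<sigma>)"
  shows "entails TYPE('a) \<Omega> (gnd_eqns \<Omega> M E) (s \<cdot> \<sigma>, t \<cdot> \<sigma>)"
proof -
  have "eval I \<beta> (s \<cdot> \<sigma>) = eval I \<beta> (t \<cdot> \<sigma>)"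
    if model: "\<forall>e \<in> gnd_eqns \<Omega> M E. satisfies D I e" and \<beta>: "range \<beta> \<subseteq> D"
    for D :: "'a set" and I \<beta>
  proof -
    have eq: "eval I \<beta> (a \<cdot> \<delta>) = eval I \<beta> (b \<cdot> \<delta>)"
      if "(a, b) \<in> E" "is_subst \<Omega> \<delta>" "a \<cdot> \<delta> \<in> M" "b \<cdot> \<delta> \<in> M" for a b \<delta>
    proof -
      have "(a \<cdot> \<delta>, b \<cdot> \<delta>) \<in> gnd_eqns \<Omega> M E" using that by (auto simp: gnd_eqns_def)
      then show ?thesis using model \<beta> by (fastforce simp: satisfies_def)
    qed
    have cong: "eval I \<beta> (Fun f us) = eval I \<beta> (Fun f vs)"
      if "map (eval I \<beta>) us = map (eval I \<beta>) vs" for f us vs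
      by (simp add: that)
    \<comment> \<open>The abstract \<open>h\<close> becomes evaluation in the given model, which
      satisfies \<open>eq\<close> and \<open>cong\<close>.\<close>
    have "consistent \<Omega> M (eval I \<beta>) (sep_vars A) A"
      using consistent_run[OF assms(10) _ eq cong] assms(6,11-14) by blast
    note con = consistent_norm[OF this assms(15)]
    \<comment> \<open>The two satisfiability assumptions complete \<open>\<sigma>\<close>
      independently on the remaining variables of the constraints, so \<open>\<eta>\<close> and
      \<open>\<eta>'\<close> may differ.\<close>
    obtain \<eta> where \<eta>: "is_subst \<Omega> \<eta>" "holds M \<Gamma> (\<lambda>x. \<sigma> x \<cdot> \<eta>)"
      using satisfiable_holds[OF assms(20)] .
    obtain \<eta>' where \<eta>': "is_subst \<Omega> \<eta>'" "holds M \<Delta> (\<lambda>x. \<sigma> x \<cdot> \<eta>')"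
      using satisfiable_holds[OF assms(21)] .
    \<comment> \<open>On separating variables the completions have no effect: these variables occur
      in \<open>s\<close>, so \<open>\<sigma>\<close> already makes them ground.\<close>
    have "\<sigma> x \<cdot> \<eta> = \<sigma> x \<cdot> \<eta>'" if "x \<in> sep_vars A" for x
    proof -
      have "x \<in> vars s" using sep_vars_norm[OF assms(15), of \<Gamma> s] assms(16) that by blast
      then have "ground (\<sigma> x)" using assms(18) by (auto simp: ground_def vars_subst)
      then show ?thesis by (simp add: ground_subst)
    qed
    then have "eval I \<beta> (s \<cdot> (\<lambda>x. \<sigma> x \<cdot> \<eta>)) = eval I \<beta> (t \<cdot> (\<lambda>x. \<sigma> x \<cdot> \<eta>'))"
      using consistentD[OF con _ _ is_subst_comp[OF assms(17) \<eta>(1)]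
          is_subst_comp[OF assms(17) \<eta>'(1)] \<eta>(2) \<eta>'(2)] assms(16) by blast
    \<comment> \<open>The completions also leave the ground terms \<open>s \<cdot> \<sigma>\<close>
      and \<open>t \<cdot> \<sigma>\<close> unchanged.\<close>
    then show ?thesis
      using assms(18,19) by (simp flip: subst_subst add: ground_subst)
  qed
  then show ?thesis
    by (auto simp: entails_def satisfies_def[of _ _ "(s \<cdot> \<sigma>, t \<cdot> \<sigma>)"])
qed

end
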